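(* Suppose Assumption A (stated in the context) holds. Then the following statements are equivalent: 1) $(\bm{x}^*,\bm{\lambda}^* )\in\Omega\times\mathbb{R}^{MN}_+$ satisfies $\bm{0}\in\Pi_{\Omega}\big(\bm{x}^*,-\partial_{\bm{x}}\tilde{\mathcal{L}}(\bm{x}^*,\bm{\lambda}^* )\big)$ and $\bm{0}\in\Pi_{\mathbb{R}^{MN}_+}\big(\bm{\lambda}^*,-\partial_{\bm{\lambda}}(-\tilde{\mathcal{L}})(\bm{x}^*,\bm{\lambda}^* )\big)$. 2) $(\bm{x}^*,\bm{\lambda}^* )$ is a saddle point of $\tilde{\mathcal{L}}$ in $\Omega\times\mathbb{R}^{MN}_+$, i.e. $\tilde{\mathcal{L}}(\bm{x}^*,\bm{\lambda})\le\tilde{\mathcal{L}}(\bm{x}^*,\bm{\lambda}^* )\le\tilde{\mathcal{L}}(\bm{x},\bm{\lambda}^* )$ for all $\bm{x}\in\Omega$, $\bm{\lambda}\in\mathbb{R}^{MN}_+$. 3) $\bm{\lambda}^*=\mathrm{col}(\lambda^*,\dots,\lambda^* )$ and $(\bm{x}^*,\lambda^* )$ is a saddle point of $\mathcal{L}$ in $\Omega\times\mathbb{R}^M_+$, i.e. $\mathcal{L}(\bm{x}^*,\lambda)\le\mathcal{L}(\bm{x}^*,\lambda^* )\le\mathcal{L}(\bm{x},\lambda^* )$ for all $\bm{x}\in\Omega$, $\lambda\in\mathbb{R}^M_+$.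
   Context: Setting. Let $\mathcal{G}=(\mathcal{V},\mathcal{E})$ be a graph with node set $\mathcal{V}=\{1,\dots,N\}$; $\mathcal{N}_i$ is the set of neighbors of node $i$. For each $i\in\mathcal{V}$ let $\Omega_i\subset\mathbb{R}^{n_i}$, let $f_i$ be a real-valued function and $\bm{g}_i=(g_{i1},\dots,g_{iM})^T$ a continuous $\mathbb{R}^M$-valued map, both defined on an open set containing $\Omega_i$. Write $\bm{x}=\mathrm{col}(x_1,\dots,x_N)$ for the stacked vector, $\Omega=\prod_{i\in\mathcal{V}}\Omega_i$, $f(\bm{x})=\sum_{i\in\mathcal{V}}f_i(x_i)$, $\bm{g}(\bm{x})=\sum_{i\in\mathcal{V}}\bm{g}_i(x_i)$. The underlying problem is to minimize $f(\bm{x})$ over $\bm{x}\in\Omega$ subject to $\bm{g}(\bm{x})\le\bm{0}$. Vector inequalities are componentwise; $|\cdot|$ is the $\ell_1$-norm of vectors; $\mathbb{R}^n_+$ is the set of vectors in $\mathbb{R}^n$ with nonnegative components. Assumption A. (1) For every $i\in\mathcal{V}$, $\Omega_i$ is compact and convex, and on an open set containing $\Omega_i$, $f_i$ is strictly convex, $\bm{g}_i$ is convex (i.e. each $g_{ik}$ is convex), and $f_i$, $\bm{g}_i$ are locally Lipschitz continuous. (2) There is $\bar{\bm{x}}$ in the relative interior of $\Omega$ with $\bm{g}(\bar{\bm{x}})<\bm{0}$. (3) $\mathcal{G}$ is connected and undirected. The Lagrangian is $\mathcal{L}(\bm{x},\lambda)=f(\bm{x})+\lambda^T\bm{g}(\bm{x})$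 for $\bm{x}\in\Omega$, $\lambda\in\mathbb{R}^M_+$. For $\bm{\lambda}=\mathrm{col}(\lambda_1,\dots,\lambda_N)$ with $\lambda_i\in\mathbb{R}^M_+$, the modified Lagrangian, with a constant $K>0$, is $$\tilde{\mathcal{L}}(\bm{x},\bm{\lambda})=\sum_{i\in\mathcal{V}}\big(f_i(x_i)+\lambda_i^T\bm{g}_i(x_i)\big)-K\phi(\bm{\lambda}),\qquad \phi(\bm{\lambda})=\tfrac12\sum_{i\in\mathcal{V}}\sum_{j\in\mathcal{N}_i}|\lambda_i-\lambda_j|.$$ It is convex in $\bm{x}$ and concave in $\bm{\lambda}$. $\partial_{\bm{x}}\tilde{\mathcal{L}}$ is the subdifferential in $\bm{x}$, and $\partial_{\bm{\lambda}}(-\tilde{\mathcal{L}})$ is the subdifferential of the convex function $-\tilde{\mathcal{L}}$ in $\bm{\lambda}$ (the formula for $\tilde{\mathcal{L}}$ being used for all $\bm{\lambda}\in\mathbb{R}^{MN}$). The $i$-th block of $\partial_{\bm{x}}\tilde{\mathcal{L}}$ is $\partial f_i(x_i)+\partial\bm{g}_i(x_i)\lambda_i$ (meaning $\partial f_i(x_i)+\sum_k\lambda_{ik}\partial g_{ik}(x_i)$). For a closed convex set $C\subset\mathbb{R}^n$ and $x\in C$, the tangent cone $\mathcal{T}_C(x)$ is the set of limits $\lim_k (x_k-x)/t_k$ with $x_k\in C$, $x_k\to x$, $t_k>0$, $t_k\to0$; $P_C$ is Euclidean projection onto $C$; and $\Pi_C(x,z)=P_{\mathcal{T}_C(x)}(z)$,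 with $\Pi_C(x,Z)=\{\Pi_C(x,z):z\in Z\}$ for a set $Z$.
   Formalization: Statements 1) and 2) are proved equivalent for every K>0; their equivalence with 3) is proved only for all K ≥ K0, where K0>0 depends on the problem data but not on (x*,λ* ), since for small K it is false. *)

theory Defs
  imports "HOL-Analysis.Analysis"
begin

section \<open>Convex-analysis notions\<close>

definition strictly_convex_on :: "'a::real_vector set \<Rightarrow> ('a \<Rightarrow> real) \<Rightarrow> bool" where
  "strictly_convex_on S f \<longleftrightarrow> convex S \<and>
     (\<forall>x\<in>S. \<forall>y\<in>S. \<forall>u>0. \<forall>v>0. x \<noteq> y \<and> u + v = 1 \<longrightarrow>
        f (u *\<^sub>R x + v *\<^sub>R y) < u * f x + v * f y)"

definition locally_lipschitz_on ::
    "'a::metric_space set \<Rightarrow> ('a \<Rightarrow> 'b::metric_space) \<Rightarrow> bool" where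
  "locally_lipschitz_on S f \<longleftrightarrow> local_lipschitz (UNIV :: real set) S (\<lambda>_. f)"

text \<open>HOL functions are total, so the domain \<open>U\<close> of \<open>h\<close> has to be an argument: the subgradient
  inequality is required on \<open>U\<close> only.\<close>

definition subdifferential :: "'a::real_inner set \<Rightarrow> ('a \<Rightarrow> real) \<Rightarrow> 'a \<Rightarrow> 'a set" where
  "subdifferential U h x = {z. \<forall>y\<in>U. h x + z \<bullet> (y - x) \<le> h y}"

definition tangent_cone :: "'a::real_normed_vector set \<Rightarrow> 'a \<Rightarrow> 'a set" where
  "tangent_cone C x =
     {v. \<exists>(xs :: nat \<Rightarrow> 'a) (t :: nat \<Rightarrow> real).
           (\<forall>k. xs k \<in> C) \<and> xs \<longlonglongrightarrow> x \<and> (\<forall>k. t k > 0) \<and> t \<longlonglongrightarrow> 0 \<and>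
           (\<lambda>k. (xs k - x) /\<^sub>R t k) \<longlonglongrightarrow> v}"

definition tangent_proj :: "'a::euclidean_space set \<Rightarrow> 'a \<Rightarrow> 'a \<Rightarrow> 'a" where
  "tangent_proj C x z = closest_point (tangent_cone C x) z"

definition saddle_point :: "('a \<Rightarrow> 'b \<Rightarrow> real) \<Rightarrow> 'a set \<Rightarrow> 'b set \<Rightarrow> 'a \<Rightarrow> 'b \<Rightarrow> bool" where
  "saddle_point L X Y x l \<longleftrightarrow> x \<in> X \<and> l \<in> Y \<and>
     (\<forall>x'\<in>X. \<forall>l'\<in>Y. L x l' \<le> L x l \<and> L x l \<le> L x' l)"

definition l1_norm :: "real ^ 'm \<Rightarrow> real" where
  "l1_norm v = (\<Sum>k\<in>UNIV. \<bar>v $ k\<bar>)"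

definition nonneg_orthant :: "(real ^ 'm) set" where
  "nonneg_orthant = {l. \<forall>k. 0 \<le> l $ k}"


section \<open>Stacked vectors with blocks of different dimensions\<close>

text \<open>The nodes are the elements of a finite type \<open>'v\<close>. The stacked vector \<open>col(x\<^sub>1, \<dots>, x\<^sub>N)\<close> is a
  vector in \<open>real ^ 'd\<close>, and \<open>node :: 'd \<Rightarrow> 'v\<close> tells to which node a coordinate belongs, so that
  \<open>n\<^sub>i\<close> is the number of coordinates \<open>d\<close> with \<open>node d = i\<close>. The space of node \<open>i\<close> is the
  \<open>n\<^sub>i\<close>-dimensional coordinate subspace \<open>block_space node i\<close>, and \<open>x\<^sub>i\<close> is \<open>block node i x\<close>.
  The stacked multiplier is an element of \<open>real ^ 'm ^ 'v\<close>, with \<open>\<lambda>\<^sub>i\<close> being \<open>l $ i\<close>.\<close>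

definition block_space :: "('d \<Rightarrow> 'v) \<Rightarrow> 'v \<Rightarrow> (real ^ 'd) set" where
  "block_space node i = {x. \<forall>d. node d \<noteq> i \<longrightarrow> x $ d = 0}"

definition block :: "('d \<Rightarrow> 'v) \<Rightarrow> 'v \<Rightarrow> real ^ 'd \<Rightarrow> real ^ 'd" where
  "block node i x = (\<chi> d. if node d = i then x $ d else 0)"

definition block_prod :: "('d \<Rightarrow> 'v) \<Rightarrow> ('v \<Rightarrow> (real ^ 'd) set) \<Rightarrow> (real ^ 'd) set" where
  "block_prod node S = {x. \<forall>i. block node i x \<in> S i}"

definition multiplier_orthant :: "(real ^ 'm ^ 'v) set" where
  "multiplier_orthant = {l. \<forall>i. l $ i \<in> nonneg_orthant}"


section \<open>The Lagrangian and the modified Lagrangian\<close>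

definition total_cost ::
    "('d \<Rightarrow> 'v::finite) \<Rightarrow> ('v \<Rightarrow> real ^ 'd \<Rightarrow> real) \<Rightarrow> real ^ 'd \<Rightarrow> real" where
  "total_cost node f x = (\<Sum>i\<in>UNIV. f i (block node i x))"

definition total_constraint ::
    "('d \<Rightarrow> 'v::finite) \<Rightarrow> ('v \<Rightarrow> real ^ 'd \<Rightarrow> real ^ 'm) \<Rightarrow> real ^ 'd \<Rightarrow> real ^ 'm" where
  "total_constraint node g x = (\<Sum>i\<in>UNIV. g i (block node i x))"

definition lagrangian ::
    "('d \<Rightarrow> 'v::finite) \<Rightarrow> ('v \<Rightarrow> real ^ 'd \<Rightarrow> real) \<Rightarrow> ('v \<Rightarrow> real ^ 'd \<Rightarrow> real ^ 'm) \<Rightarrow>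
     real ^ 'd \<Rightarrow> real ^ 'm \<Rightarrow> real" where
  "lagrangian node f g x l = total_cost node f x + l \<bullet> total_constraint node g x"

definition neighbors :: "('v \<times> 'v) set \<Rightarrow> 'v \<Rightarrow> 'v set" where
  "neighbors E i = {j. (i, j) \<in> E}"

definition disagreement :: "('v::finite \<times> 'v) set \<Rightarrow> real ^ 'm ^ 'v \<Rightarrow> real" where
  "disagreement E l = 1 / 2 * (\<Sum>i\<in>UNIV. \<Sum>j\<in>neighbors E i. l1_norm (l $ i - l $ j))"

definition modified_lagrangian ::
    "('d \<Rightarrow> 'v::finite) \<Rightarrow> ('v \<times> 'v) set \<Rightarrow> real \<Rightarrow>
     ('v \<Rightarrow> real ^ 'd \<Rightarrow> real) \<Rightarrow> ('v \<Rightarrow> real ^ 'd \<Rightarrow> real ^ 'm) \<Rightarrow>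
     real ^ 'd \<Rightarrow> real ^ 'm ^ 'v \<Rightarrow> real" where
  "modified_lagrangian node E K f g x l =
     (\<Sum>i\<in>UNIV. f i (block node i x) + (l $ i) \<bullet> g i (block node i x)) - K * disagreement E l"


section \<open>The three conditions\<close>

text \<open>\<open>U i\<close> is the open set containing \<open>\<Omega> i\<close> on which \<open>f i\<close> and \<open>g i\<close> are considered, so the
  modified Lagrangian is a function of \<open>x\<close> on \<open>block_prod node U\<close>; in the multipliers it is
  defined everywhere.\<close>

definition projected_equilibrium ::
    "('d::finite \<Rightarrow> 'v::finite) \<Rightarrow> ('v \<times> 'v) set \<Rightarrow> real \<Rightarrow> ('v \<Rightarrow> (real ^ 'd) set) \<Rightarrow>
     ('v \<Rightarrow> (real ^ 'd) set) \<Rightarrow> ('v \<Rightarrow> real ^ 'd \<Rightarrow> real) \<Rightarrow> ('v \<Rightarrow> real ^ 'd \<Rightarrow> real ^ 'm::finite) \<Rightarrow>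
     real ^ 'd \<Rightarrow> real ^ 'm ^ 'v \<Rightarrow> bool" where
  "projected_equilibrium node E K U \<Omega> f g x l \<longleftrightarrow>
     x \<in> block_prod node \<Omega> \<and> l \<in> multiplier_orthant \<and>
     0 \<in> (\<lambda>z. tangent_proj (block_prod node \<Omega>) x (- z)) `
           subdifferential (block_prod node U) (\<lambda>y. modified_lagrangian node E K f g y l) x \<and>
     0 \<in> (\<lambda>z. tangent_proj multiplier_orthant l (- z)) `
           subdifferential UNIV (\<lambda>m. - modified_lagrangian node E K f g x m) l"

definition modified_saddle ::
    "('d \<Rightarrow> 'v::finite) \<Rightarrow> ('v \<times> 'v) set \<Rightarrow> real \<Rightarrow> ('v \<Rightarrow> (real ^ 'd) set) \<Rightarrow>
     ('v \<Rightarrow> real ^ 'd \<Rightarrow> real) \<Rightarrow> ('v \<Rightarrow> real ^ 'd \<Rightarrow> real ^ 'm) \<Rightarrow>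
     real ^ 'd \<Rightarrow> real ^ 'm ^ 'v \<Rightarrow> bool" where
  "modified_saddle node E K \<Omega> f g x l \<longleftrightarrow>
     saddle_point (modified_lagrangian node E K f g) (block_prod node \<Omega>) multiplier_orthant x l"

definition consensus_saddle ::
    "('d \<Rightarrow> 'v::finite) \<Rightarrow> ('v \<Rightarrow> (real ^ 'd) set) \<Rightarrow>
     ('v \<Rightarrow> real ^ 'd \<Rightarrow> real) \<Rightarrow> ('v \<Rightarrow> real ^ 'd \<Rightarrow> real ^ 'm) \<Rightarrow>
     real ^ 'd \<Rightarrow> real ^ 'm ^ 'v \<Rightarrow> bool" where
  "consensus_saddle node \<Omega> f g x l \<longleftrightarrow>
     (\<exists>l0. l = (\<chi> i. l0) \<and>
        saddle_point (lagrangian node f g) (block_prod node \<Omega>) nonneg_orthant x l0)"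

text \<open>Pitfall: the penalty \<open>K * disagreement\<close> is exact only for large \<open>K\<close>. With two adjacent nodes,
  \<open>f\<^sub>1(x) = (x - 5)\<^sup>2\<close>, \<open>f\<^sub>2(x) = (x + 5)\<^sup>2\<close>, \<open>g\<^sub>1(x) = g\<^sub>2(x) = x\<close> and
  \<open>\<Omega>\<^sub>1 = \<Omega>\<^sub>2 = [-10, 10]\<close>, the point \<open>x = (5, -5)\<close> with zero multiplier is a saddle point of the
  Lagrangian, but for \<open>K < 5\<close> it is not one of the modified Lagrangian: the multipliers
  \<open>(s, 0)\<close> contribute \<open>(5 - K) s > 0\<close>.\<close>

end

theory Submission
  imports Defs
begin

text \<open>
  A saddle point is a pair in which \<open>x\<close> minimizes a convex function over \<open>block_prod node \<Omega>\<close> and \<open>l\<close>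
  minimizes a convex function over the orthant of multipliers, so the projected conditions only
  have to be recognised as the first-order conditions of these two convex programs. For a convex
  set \<open>C\<close>, the projection of \<open>w\<close> onto the tangent cone at \<open>x\<close> vanishes iff \<open>w\<close> is normal to \<open>C\<close>
  at \<open>x\<close> (\<open>tangent_proj_eq_0_iff\<close>), and a point minimizes \<open>h\<close> over \<open>C\<close> iff some subgradient of
  \<open>h\<close> there has a normal negative (\<open>convex_minimizer_normal_subgradient\<close>). This argument works for
  every value of the penalty parameter.

  The passage to consensus is the exactness of a nonsmooth penalty. In a connected graph the
  disagreement dominates every difference \<open>l $ i - l $ j\<close> up to a constant, whereas the linear part
  of the modified Lagrangian changes at most proportionally to these differences, uniformly in \<open>x\<close>
  because the constraint maps are bounded on compact sets. Hence for large \<open>K\<close> replacing all the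
  multipliers by one of them increases the modified Lagrangian by at least the disagreement
  (\<open>consensus_replacement_gain\<close>). A maximizer therefore has disagreement zero, and on consensus
  multipliers the modified Lagrangian is the Lagrangian. Conversely, the same inequality bounds
  the modified Lagrangian at arbitrary multipliers by a value of the Lagrangian, so that a saddle
  point of the latter is one of the former.
\<close>

section \<open>Projections onto tangent cones\<close>

text \<open>This description shows that the tangent cone is closed and contains all directions into \<open>C\<close>.\<close>

lemma tangent_cone_closure:
  fixes C :: "'a::real_normed_vector set"
  assumes "convex C" and "x \<in> C"
  shows "tangent_cone C x = closure {t *\<^sub>R (y - x) |t y. t > 0 \<and> y \<in> C}" (is "_ = closure ?D")
proof (intro equalityI subsetI)
  fix v assume "v \<in> tangent_cone C x"
  then obtain xs t where "\<And>k::nat. xs k \<in> C" "\<And>k. t k > (0::real)"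
    and lim: "(\<lambda>k. (xs k - x) /\<^sub>R t k) \<longlonglongrightarrow> v"
    unfolding tangent_cone_def by blast
  then have "\<forall>k. (xs k - x) /\<^sub>R t k \<in> ?D"
    by (metis (mono_tags, lifting) mem_Collect_eq positive_imp_inverse_positive)
  then show "v \<in> closure ?D"
    using lim unfolding closure_sequential by (intro exI[of _ "\<lambda>k. (xs k - x) /\<^sub>R t k"]) simp
next
  fix v assume "v \<in> closure ?D"
  then obtain w where w: "\<And>k::nat. w k \<in> ?D" and lim: "w \<longlonglongrightarrow> v"
    unfolding closure_sequential by blast
  have "\<forall>k. \<exists>t y. t > 0 \<and> y \<in> C \<and> w k = t *\<^sub>R (y - x)"
    using w by blast
  then obtain t y where t: "\<And>k. t k > (0::real)" and y: "\<And>k. y k \<in> C"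
    and wk: "\<And>k. w k = t k *\<^sub>R (y k - x)"
    by metis
  \<comment> \<open>Steps this short keep the points on the segments from \<open>x\<close> to \<open>y k\<close>, hence in \<open>C\<close>.\<close>
  define s where "s k = inverse (real (Suc k)) * inverse (t k + 1)" for k
  have s_pos: "s k > 0" for k
    using t[of k] by (simp add: s_def)
  have s_le: "s k \<le> inverse (real (Suc k))" for k
    unfolding s_def using t[of k] by (intro mult_left_le) (auto simp: inverse_le_1_iff)
  have s_t: "s k * t k \<le> 1" for k
  proof -
    have "s k * t k \<le> inverse (t k + 1) * t k"
      unfolding s_def using t[of k]
      by (intro mult_right_mono mult_left_le_one_le) (auto simp: inverse_le_1_iff)
    also have "\<dots> \<le> 1"
      using t[of k] by (simp add: field_simps)
    finally show ?thesis .
  qed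
  have s_lim: "s \<longlonglongrightarrow> 0"
    using s_pos s_le
    by (intro tendsto_sandwich[OF _ _ tendsto_const LIMSEQ_inverse_real_of_nat])
      (auto intro!: always_eventually less_imp_le simp del: of_nat_Suc)
  define xs where "xs k = x + s k *\<^sub>R w k" for k
  have "xs k \<in> C" for k
  proof -
    have "xs k = (1 - s k * t k) *\<^sub>R x + (s k * t k) *\<^sub>R y k"
      by (simp add: xs_def wk algebra_simps)
    then show ?thesis
      using convexD[OF \<open>convex C\<close> \<open>x \<in> C\<close> y[of k], of "1 - s k * t k" "s k * t k"] s_t[of k] s_pos[of k] t[of k]
      by simp
  qed
  moreover have "xs \<longlonglongrightarrow> x"
    unfolding xs_def using tendsto_add[OF tendsto_const tendsto_scaleR[OF s_lim lim], of x] by simp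
  moreover have "(\<lambda>k. (xs k - x) /\<^sub>R s k) \<longlonglongrightarrow> v"
  proof -
    have "(xs k - x) /\<^sub>R s k = w k" for k
      using s_pos[of k] by (simp add: xs_def)
    then show ?thesis using lim by simp
  qed
  ultimately show "v \<in> tangent_cone C x"
    unfolding tangent_cone_def using s_pos s_lim by blast
qed

text \<open>Closedness of the tangent cone guarantees that the projection exists. If it is \<open>0\<close>, a direction
  \<open>y - x\<close> with positive inner product would have a multiple closer to \<open>w\<close>; conversely, if \<open>w\<close> is
  normal to \<open>C\<close>, it is also polar to the closure of these directions, so \<open>0\<close> is closest to \<open>w\<close>.\<close>

lemma tangent_proj_eq_0_iff:
  fixes C :: "'a::euclidean_space set"
  assumes "convex C" and "x \<in> C"
  shows "tangent_proj C x w = 0 \<longleftrightarrow> (\<forall>y\<in>C. w \<bullet> (y - x) \<le> 0)"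
proof
  let ?T = "tangent_cone C x"
  have T: "?T = closure {t *\<^sub>R (y - x) |t y. t > 0 \<and> y \<in> C}"
    using assms by (rule tangent_cone_closure)
  have dir: "t *\<^sub>R (y - x) \<in> ?T" if "t > 0" "y \<in> C" for t y
    unfolding T using that by (intro closure_subset[THEN subsetD]) blast
  have zero: "0 \<in> ?T"
    using dir[of 1 x] \<open>x \<in> C\<close> by simp
  have closed: "closed ?T"
    unfolding T by simp
  {
    assume proj: "tangent_proj C x w = 0"
    have min: "dist w 0 \<le> dist w v" if "v \<in> ?T" for v
      using closest_point_le[OF closed that, of w] proj unfolding tangent_proj_def by simp
    show "\<forall>y\<in>C. w \<bullet> (y - x) \<le> 0"
    proof (rule ballI, rule ccontr)
      fix y assume "y \<in> C" and "\<not> w \<bullet> (y - x) \<le> 0"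
      then have pos: "w \<bullet> (y - x) > 0" by simp
      define d where "d = y - x"
      have "d \<noteq> 0" using pos by (auto simp: d_def)
      \<comment> \<open>This step along \<open>d\<close> minimizes the distance to \<open>w\<close>.\<close>
      define t where "t = (w \<bullet> d) / (d \<bullet> d)"
      have "t > 0" using pos \<open>d \<noteq> 0\<close> by (simp add: t_def d_def)
      have "norm w \<le> norm (w - t *\<^sub>R d)"
        using min[OF dir[OF \<open>t > 0\<close> \<open>y \<in> C\<close>]] by (simp add: d_def dist_norm)
      then have "w \<bullet> w \<le> (w - t *\<^sub>R d) \<bullet> (w - t *\<^sub>R d)"
        by (simp add: norm_le)
      also have "\<dots> = w \<bullet> w - t * (w \<bullet> d)"
        using \<open>d \<noteq> 0\<close> by (simp add: t_def inner_diff inner_commute field_simps)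
      finally show False
        using mult_pos_pos[OF \<open>t > 0\<close> pos] by (simp add: d_def)
    qed
  next
    assume normal: "\<forall>y\<in>C. w \<bullet> (y - x) \<le> 0"
    have "?T \<subseteq> {v. w \<bullet> v \<le> 0}"
      unfolding T using normal
      by (intro closure_minimal closed_halfspace_le) (auto simp: mult_nonneg_nonpos)
    then have polar: "w \<bullet> v \<le> 0" if "v \<in> ?T" for v using that by blast
    define p where "p = tangent_proj C x w"
    have "p \<in> ?T"
      unfolding p_def tangent_proj_def using closed zero by (auto intro: closest_point_in_set)
    have "norm (w - p) \<le> norm w"
      using closest_point_le[OF closed zero, of w]
      unfolding p_def tangent_proj_def by (simp add: dist_norm)
    then have "(w - p) \<bullet> (w - p) \<le> w \<bullet> w"
      by (simp add: norm_le)
    then have "p \<bullet> p \<le> 2 * (w \<bullet> p)"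
      by (simp add: inner_diff inner_commute)
    then have "p \<bullet> p \<le> 0"
      using polar[OF \<open>p \<in> ?T\<close>] by linarith
    then have "p = 0"
      by (metis inner_ge_zero inner_eq_zero_iff order_antisym)
    then show "tangent_proj C x w = 0"
      by (simp add: p_def)
  }
qed

section \<open>Minimizers of convex functions\<close>

text \<open>A minimizer over \<open>C\<close> makes the strict epigraph of \<open>h - h x\<close> disjoint from
  \<open>C \<times> {..0}\<close>. A separating hyperplane is not vertical because \<open>V\<close> is a neighbourhood of \<open>x\<close>,
  and its slope is a subgradient on all of \<open>V\<close> whose negative is normal to \<open>C\<close>.\<close>

lemma convex_minimizer_normal_subgradient:
  fixes h :: "'a::euclidean_space \<Rightarrow> real"
  assumes "convex_on V h" and "open V" and "convex C" and "C \<subseteq> V" and "x \<in> C"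
    and min: "\<And>y. y \<in> C \<Longrightarrow> h x \<le> h y"
  shows "\<exists>z \<in> subdifferential V h x. \<forall>y\<in>C. 0 \<le> z \<bullet> (y - x)"
proof -
  define A where "A = {p. fst p \<in> V \<and> h (fst p) - h x < snd p}"
  define B where "B = C \<times> {..0::real}"
  have "convex A"
    unfolding convex_def
  proof (intro ballI allI impI)
    fix p q :: "'a \<times> real" and u v :: real
    assume p: "p \<in> A" and q: "q \<in> A" and uv: "0 \<le> u" "0 \<le> v" "u + v = 1"
    have V: "u *\<^sub>R fst p + v *\<^sub>R fst q \<in> V"
      using p q uv convex_on_imp_convex[OF \<open>convex_on V h\<close>] by (auto simp: A_def convex_def)
    have "h (u *\<^sub>R fst p + v *\<^sub>R fst q) \<le> u * h (fst p) + v * h (fst q)"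
      using p q uv \<open>convex_on V h\<close> by (auto simp: A_def convex_on_def)
    moreover have "u * (h (fst p) - h x - snd p) + v * (h (fst q) - h x - snd q) < 0"
    proof (cases "u = 0")
      case True
      then show ?thesis using uv q by (simp add: A_def)
    next
      case False
      then have "u * (h (fst p) - h x - snd p) < 0"
        using uv p by (simp add: A_def mult_pos_neg)
      moreover have "v * (h (fst q) - h x - snd q) \<le> 0"
        using uv q by (simp add: A_def mult_nonneg_nonpos)
      ultimately show ?thesis by linarith
    qed
    moreover have "h x = u * h x + v * h x"
      using uv by (metis distrib_right mult_1)
    ultimately have "h (u *\<^sub>R fst p + v *\<^sub>R fst q) - h x < u * snd p + v * snd q"
      by (simp add: right_diff_distrib)
    with V show "u *\<^sub>R p + v *\<^sub>R q \<in> A"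
      by (simp add: A_def)
  qed
  moreover have "convex B"
    unfolding B_def using \<open>convex C\<close> by (intro convex_Times) auto
  moreover have "A \<noteq> {}"
    using \<open>x \<in> C\<close> \<open>C \<subseteq> V\<close> by (auto simp: A_def intro!: exI[of _ x] exI[of _ 1])
  moreover have "B \<noteq> {}"
    using \<open>x \<in> C\<close> by (auto simp: B_def)
  moreover have "A \<inter> B = {}"
    using min by (force simp: A_def B_def)
  ultimately obtain n c where "n \<noteq> 0" and nB: "\<forall>p\<in>B. n \<bullet> p \<le> c" and nA: "\<forall>p\<in>A. n \<bullet> p \<ge> c"
    using separating_hyperplane_sets[of B A] by (metis inf_commute)
  obtain a b where n: "n = (a, b)" by fastforce
  have C: "a \<bullet> y \<le> c" if "y \<in> C" for y
    using nB that by (force simp: B_def n)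
  have V: "c \<le> a \<bullet> y + b * r" if "y \<in> V" "h y - h x < r" for y r
    using nA that by (force simp: A_def n)
  have "x \<in> V" using assms by blast
  have b_nonneg: "b \<ge> 0"
  proof (rule ccontr)
    assume "\<not> b \<ge> 0"
    \<comment> \<open>With \<open>b < 0\<close> the heights above \<open>x\<close> would make the functional arbitrarily negative; at this
      height it equals \<open>c - 1\<close>.\<close>
    then show False
      using V[OF \<open>x \<in> V\<close>, of 1] V[OF \<open>x \<in> V\<close>, of "1 + (c - a \<bullet> x - b - 1) / b"]
      by (simp add: field_simps)
  qed
  have V': "c \<le> a \<bullet> y + b * (h y - h x)" if "y \<in> V" for y
  proof (rule field_le_epsilon)
    fix e :: real assume "0 < e"
    \<comment> \<open>The denominator \<open>b + 1\<close> keeps \<open>r\<close> meaningful while \<open>b = 0\<close> has not been excluded.\<close>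
    define r where "r = h y - h x + e / (b + 1)"
    have "b / (b + 1) * e \<le> 1 * e"
      using b_nonneg \<open>0 < e\<close> by (intro mult_right_mono) auto
    moreover have "c \<le> a \<bullet> y + b * r"
      using V[OF that, of r] b_nonneg \<open>0 < e\<close> by (simp add: r_def)
    ultimately show "c \<le> a \<bullet> y + b * (h y - h x) + e"
      by (simp add: r_def algebra_simps)
  qed
  have c: "c = a \<bullet> x"
    using V'[OF \<open>x \<in> V\<close>] C[OF \<open>x \<in> C\<close>] by simp
  have "b \<noteq> 0"
  proof
    assume "b = 0"
    obtain e where "e > 0" and e: "ball x e \<subseteq> V"
      using \<open>open V\<close> \<open>x \<in> V\<close> openE by blast
    have "a \<noteq> 0" using \<open>n \<noteq> 0\<close> n \<open>b = 0\<close> by (auto simp: zero_prod_def)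
    \<comment> \<open>A short step from \<open>x\<close> against \<open>a\<close>, along which the linear functional strictly decreases.\<close>
    define y where "y = x - (e / (2 * norm a)) *\<^sub>R a"
    have "y \<in> ball x e"
      using \<open>e > 0\<close> \<open>a \<noteq> 0\<close> by (simp add: y_def dist_norm)
    then have "a \<bullet> x \<le> a \<bullet> y"
      using V'[of y] e \<open>b = 0\<close> c by auto
    moreover have "a \<bullet> y = a \<bullet> x - e / (2 * norm a) * (a \<bullet> a)"
      by (simp add: y_def inner_diff_right)
    moreover have "e / (2 * norm a) * (a \<bullet> a) > 0"
      using \<open>e > 0\<close> \<open>a \<noteq> 0\<close> by (intro mult_pos_pos) auto
    ultimately show False by linarith
  qed
  then have "b > 0" using b_nonneg by simp
  define z where "z = - (inverse b *\<^sub>R a)"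
  have z: "b * (z \<bullet> (y - x)) = a \<bullet> x - a \<bullet> y" for y
    using \<open>b > 0\<close> by (simp add: z_def inner_diff_right field_simps)
  have "h x + z \<bullet> (y - x) \<le> h y" if "y \<in> V" for y
  proof -
    have "b * (z \<bullet> (y - x)) \<le> b * (h y - h x)"
      using V'[OF that] c z[of y] by linarith
    then show ?thesis using \<open>b > 0\<close> by simp
  qed
  moreover have "0 \<le> z \<bullet> (y - x)" if "y \<in> C" for y
  proof -
    have "0 \<le> b * (z \<bullet> (y - x))"
      using C[OF that] c z[of y] by linarith
    then show ?thesis using \<open>b > 0\<close> by (simp add: zero_le_mult_iff)
  qed
  ultimately show ?thesis
    unfolding subdifferential_def by blast
qed

lemma projected_stationary_iff_minimizer:
  fixes h :: "'a::euclidean_space \<Rightarrow> real"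
  assumes "convex_on V h" and "open V" and "convex C" and "C \<subseteq> V" and "x \<in> C"
  shows "0 \<in> (\<lambda>z. tangent_proj C x (- z)) ` subdifferential V h x \<longleftrightarrow> (\<forall>y\<in>C. h x \<le> h y)"
proof -
  have "0 \<in> (\<lambda>z. tangent_proj C x (- z)) ` subdifferential V h x \<longleftrightarrow>
      (\<exists>z \<in> subdifferential V h x. \<forall>y\<in>C. 0 \<le> z \<bullet> (y - x))"
    using tangent_proj_eq_0_iff[OF \<open>convex C\<close> \<open>x \<in> C\<close>] by (auto simp: image_iff eq_commute[of 0])
  also have "\<dots> \<longleftrightarrow> (\<forall>y\<in>C. h x \<le> h y)"
  proof
    assume "\<exists>z \<in> subdifferential V h x. \<forall>y\<in>C. 0 \<le> z \<bullet> (y - x)"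
    then show "\<forall>y\<in>C. h x \<le> h y"
      using \<open>C \<subseteq> V\<close> unfolding subdifferential_def by fastforce
  next
    assume "\<forall>y\<in>C. h x \<le> h y"
    then show "\<exists>z \<in> subdifferential V h x. \<forall>y\<in>C. 0 \<le> z \<bullet> (y - x)"
      using convex_minimizer_normal_subgradient[OF assms] by blast
  qed
  finally show ?thesis .
qed

section \<open>Convexity of the modified Lagrangian in each argument\<close>

lemma linear_block: "linear (block node i)"
  by (rule linearI) (auto simp: block_def vec_eq_iff)

lemma convex_block_prod:
  assumes "\<And>i. convex (S i)"
  shows "convex (block_prod node S)"
proof -
  have "block_prod node S = (\<Inter>i. block node i -` S i)"
    by (auto simp: block_prod_def)
  then show ?thesis
    using assms by (auto intro!: convex_INT convex_linear_vimage linear_block)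
qed

text \<open>Blocks take values in the block spaces, so relative openness of the factors is enough.\<close>

lemma open_block_prod:
  fixes node :: "'d::finite \<Rightarrow> 'v::finite"
  assumes "\<And>i. openin (top_of_set (block_space node i)) (S i)"
  shows "open (block_prod node S)"
proof -
  obtain T where T: "\<And>i. open (T i)" "\<And>i. S i = block_space node i \<inter> T i"
    using assms unfolding openin_open by metis
  have "block_prod node S = (\<Inter>i. block node i -` T i)"
    by (auto simp: block_prod_def T(2) block_space_def block_def)
  then show ?thesis
    using T(1) by (auto intro!: open_INT open_vimage linear_continuous_on
        linear_linear[THEN iffD2] linear_block)
qed

lemma convex_multiplier_orthant:
  "convex (multiplier_orthant :: (real ^ 'm ^ 'v) set)"
  by (auto simp: convex_def multiplier_orthant_def nonneg_orthant_def)

lemma convex_on_sum_functions: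
  assumes "convex S" and "\<And>i. i \<in> A \<Longrightarrow> convex_on S (F i)"
  shows "convex_on S (\<lambda>x. \<Sum>i\<in>A. F i x)"
  using assms(2)
  by (induction A rule: infinite_finite_induct) (auto simp: convex_on_const assms(1))

lemma convex_on_modified_lagrangian_primal:
  fixes l :: "real ^ 'm::finite ^ 'v::finite"
  assumes f: "\<And>i. convex_on (U i) (f i)"
    and g: "\<And>i k. convex_on (U i) (\<lambda>x. g i x $ k)"
    and l: "l \<in> multiplier_orthant"
  shows "convex_on (block_prod node U) (\<lambda>x. modified_lagrangian node E K f g x l)"
proof -
  have V: "convex (block_prod node U)"
    using f by (intro convex_block_prod) (rule convex_on_imp_convex)
  have comp: "convex_on (block_prod node U) (\<lambda>x. h (block node i x))"
    if "convex_on (U i) h" for h i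
    using that V unfolding convex_on_def
    by (auto simp: linear_add[OF linear_block] linear_scale[OF linear_block] block_prod_def)
  have nonneg: "0 \<le> l $ i $ k" for i k
    using l by (simp add: multiplier_orthant_def nonneg_orthant_def)
  have "convex_on (block_prod node U)
      (\<lambda>x. (\<Sum>i\<in>UNIV. f i (block node i x) + (\<Sum>k\<in>UNIV. l $ i $ k * g i (block node i x) $ k)))"
    by (intro convex_on_sum_functions V convex_on_add comp[OF f] convex_on_cmul nonneg comp[OF g])
  then have "convex_on (block_prod node U)
      (\<lambda>x. (\<Sum>i\<in>UNIV. f i (block node i x) + (\<Sum>k\<in>UNIV. l $ i $ k * g i (block node i x) $ k))
        + (- K * disagreement E l))"
    by (rule convex_on_add) (simp add: convex_on_const V)
  then show ?thesis
    by (simp add: modified_lagrangian_def inner_vec_def)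
qed

lemma disagreement_convex:
  fixes a b :: "real ^ 'm::finite ^ 'v::finite"
  assumes "0 \<le> u" "0 \<le> v"
  shows "disagreement E (u *\<^sub>R a + v *\<^sub>R b) \<le> u * disagreement E a + v * disagreement E b"
proof -
  have "l1_norm ((u *\<^sub>R a + v *\<^sub>R b) $ i - (u *\<^sub>R a + v *\<^sub>R b) $ j)
      \<le> u * l1_norm (a $ i - a $ j) + v * l1_norm (b $ i - b $ j)" for i j
  proof -
    have "\<bar>u * p + v * q - (u * r + v * s)\<bar> \<le> u * \<bar>p - r\<bar> + v * \<bar>q - s\<bar>" for p q r s :: real
    proof -
      have "\<bar>u * p + v * q - (u * r + v * s)\<bar> = \<bar>u * (p - r) + v * (q - s)\<bar>"
        by (simp add: algebra_simps)
      also have "\<dots> \<le> \<bar>u * (p - r)\<bar> + \<bar>v * (q - s)\<bar>"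
        by (rule abs_triangle_ineq)
      finally show ?thesis using assms by (simp add: abs_mult)
    qed
    then show ?thesis
      unfolding l1_norm_def sum_distrib_left sum.distrib[symmetric] by (intro sum_mono) simp
  qed
  then have "(\<Sum>i\<in>UNIV. \<Sum>j\<in>neighbors E i. l1_norm ((u *\<^sub>R a + v *\<^sub>R b) $ i - (u *\<^sub>R a + v *\<^sub>R b) $ j))
     \<le> (\<Sum>i\<in>UNIV. \<Sum>j\<in>neighbors E i. u * l1_norm (a $ i - a $ j) + v * l1_norm (b $ i - b $ j))"
    by (intro sum_mono)
  then show ?thesis
    unfolding disagreement_def sum.distrib sum_distrib_left[symmetric] by linarith
qed

lemma convex_on_modified_lagrangian_dual:
  fixes g :: "'v::finite \<Rightarrow> real ^ 'd \<Rightarrow> real ^ 'm::finite"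
  assumes "0 \<le> K"
  shows "convex_on UNIV (\<lambda>l. - modified_lagrangian node E K f g x l)"
  unfolding convex_on_def
proof (intro conjI ballI allI impI convex_UNIV)
  fix a b :: "real ^ 'm ^ 'v" and u v :: real
  assume uv: "0 \<le> u" "0 \<le> v" "u + v = 1"
  let ?c = "\<lambda>i. f i (block node i x)" and ?d = "\<lambda>i. g i (block node i x)"
  have "K * disagreement E (u *\<^sub>R a + v *\<^sub>R b) \<le> K * (u * disagreement E a + v * disagreement E b)"
    using assms uv by (intro mult_left_mono disagreement_convex)
  moreover have "(\<Sum>i\<in>UNIV. ?c i + (u *\<^sub>R a + v *\<^sub>R b) $ i \<bullet> ?d i)
      = u * (\<Sum>i\<in>UNIV. ?c i + a $ i \<bullet> ?d i) + v * (\<Sum>i\<in>UNIV. ?c i + b $ i \<bullet> ?d i)"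
  proof -
    have "?c i = u * ?c i + v * ?c i" for i
      using uv by (metis distrib_right mult_1)
    then have "?c i + (u *\<^sub>R a + v *\<^sub>R b) $ i \<bullet> ?d i
        = u * (?c i + a $ i \<bullet> ?d i) + v * (?c i + b $ i \<bullet> ?d i)" for i
      by (simp add: inner_add_left distrib_left)
    then show ?thesis
      unfolding sum_distrib_left sum.distrib[symmetric] by (intro sum.cong refl)
  qed
  ultimately show "- modified_lagrangian node E K f g x (u *\<^sub>R a + v *\<^sub>R b)
      \<le> u * - modified_lagrangian node E K f g x a + v * - modified_lagrangian node E K f g x b"
    unfolding modified_lagrangian_def by (simp add: algebra_simps)
qed

section \<open>Exactness of the consensus penalty\<close>

lemma l1_norm_nonneg: "0 \<le> l1_norm v"
  by (simp add: l1_norm_def sum_nonneg)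

lemma disagreement_nonneg: "0 \<le> disagreement E l"
  by (simp add: disagreement_def sum_nonneg l1_norm_nonneg)

lemma disagreement_consensus [simp]: "disagreement E (\<chi> i. l0) = 0"
  by (simp add: disagreement_def l1_norm_def)

lemma modified_lagrangian_consensus:
  "modified_lagrangian node E K f g x (\<chi> i. l0) = lagrangian node f g x l0"
  by (simp add: modified_lagrangian_def lagrangian_def total_cost_def total_constraint_def
      sum.distrib inner_sum_right)

lemma edge_le_disagreement:
  fixes l :: "real ^ 'm::finite ^ 'v::finite"
  assumes "(i, j) \<in> E"
  shows "norm (l $ i - l $ j) \<le> 2 * disagreement E l"
proof -
  have "norm (l $ i - l $ j) \<le> l1_norm (l $ i - l $ j)"
    unfolding l1_norm_def by (rule norm_le_l1_cart)
  also have "\<dots> \<le> (\<Sum>j\<in>neighbors E i. l1_norm (l $ i - l $ j))"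
    using assms by (intro member_le_sum) (auto simp: neighbors_def l1_norm_nonneg)
  also have "\<dots> \<le> (\<Sum>i\<in>UNIV. \<Sum>j\<in>neighbors E i. l1_norm (l $ i - l $ j))"
    by (rule member_le_sum) (auto simp: l1_norm_nonneg sum_nonneg)
  finally show ?thesis
    by (simp add: disagreement_def)
qed

text \<open>Along a path the edge bounds add up, and there are only finitely many pairs of nodes.\<close>

lemma connected_disagreement_bound:
  fixes E :: "('v::finite \<times> 'v) set"
  assumes "\<And>i j. (i, j) \<in> E\<^sup>*"
  shows "\<exists>c>0. \<forall>i j. \<forall>l :: real ^ 'm::finite ^ 'v. norm (l $ i - l $ j) \<le> c * disagreement E l"
proof -
  have "\<exists>c. \<forall>l :: real ^ 'm ^ 'v. norm (l $ i - l $ j) \<le> c * disagreement E l" for i j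
    using assms[of i j]
  proof (induction rule: rtrancl_induct)
    case base
    show ?case by (intro exI[of _ 0]) simp
  next
    case (step j k)
    then obtain c where c: "\<And>l :: real ^ 'm ^ 'v. norm (l $ i - l $ j) \<le> c * disagreement E l"
      by blast
    have "norm (l $ i - l $ k) \<le> (c + 2) * disagreement E l" for l :: "real ^ 'm ^ 'v"
      using norm_triangle_ineq[of "l $ i - l $ j" "l $ j - l $ k"] c[of l]
        edge_le_disagreement[OF step.hyps(2), of l]
      by (simp add: algebra_simps)
    then show ?case by blast
  qed
  then obtain c where c:
    "\<And>i j. \<And>l :: real ^ 'm ^ 'v. norm (l $ i - l $ j) \<le> c i j * disagreement E l"
    by metis
  define b where "b = 1 + (\<Sum>i\<in>UNIV. \<Sum>j\<in>UNIV. \<bar>c i j\<bar>)"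
  have "c i j \<le> b" for i j
  proof -
    have "\<bar>c i j\<bar> \<le> (\<Sum>j\<in>UNIV. \<bar>c i j\<bar>)"
      by (rule member_le_sum) auto
    also have "\<dots> \<le> (\<Sum>i\<in>UNIV. \<Sum>j\<in>UNIV. \<bar>c i j\<bar>)"
      by (rule member_le_sum) (auto simp: sum_nonneg)
    finally show ?thesis by (simp add: b_def)
  qed
  then have "norm (l $ i - l $ j) \<le> b * disagreement E l" for i j and l :: "real ^ 'm ^ 'v"
    using c[of l i j] mult_right_mono[OF _ disagreement_nonneg, of "c i j" b E l]
    by (meson order_trans)
  moreover have "b > 0"
    unfolding b_def by (intro add_pos_nonneg sum_nonneg) auto
  ultimately show ?thesis by blast
qed

text \<open>Replacing every multiplier by that of the node \<open>r\<close> changes the linear part by at most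
  a fixed multiple of the disagreement, because the constraint values are bounded on the compact
  sets \<open>S i\<close>; a larger \<open>K\<close> repays this loss with something to spare. The surplus is what forces
  consensus at a maximizer.\<close>

lemma consensus_replacement_gain:
  fixes E :: "('v::finite \<times> 'v) set" and g :: "'v \<Rightarrow> real ^ 'd \<Rightarrow> real ^ 'm::finite"
  assumes bounded: "\<And>i. bounded (g i ` S i)" and connected: "\<And>i j. (i, j) \<in> E\<^sup>*"
  shows "\<exists>K0>0. \<forall>K\<ge>K0. \<forall>x\<in>block_prod node S. \<forall>(l :: real ^ 'm ^ 'v) r.
           modified_lagrangian node E K f g x l + disagreement E l
             \<le> modified_lagrangian node E K f g x (\<chi> i. l $ r)"
proof -
  obtain c where "c > 0" and c:
    "\<And>i j. \<And>l :: real ^ 'm ^ 'v. norm (l $ i - l $ j) \<le> c * disagreement E l"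
    using connected_disagreement_bound[OF connected] by blast
  obtain B where B: "\<And>i y. y \<in> S i \<Longrightarrow> norm (g i y) \<le> B i" and B_pos: "\<And>i. B i > 0"
    using bounded unfolding bounded_pos by (metis imageI)
  define b where "b = (\<Sum>i\<in>UNIV. B i)"
  define K0 where "K0 = c * b + 1"
  have "b \<ge> 0"
    unfolding b_def by (intro sum_nonneg less_imp_le[OF B_pos])
  then have "K0 > 0"
    using \<open>c > 0\<close> by (simp add: K0_def add_nonneg_pos)
  moreover have "modified_lagrangian node E K f g x l + disagreement E l
      \<le> modified_lagrangian node E K f g x (\<chi> i. l $ r)"
    if "K \<ge> K0" and x: "x \<in> block_prod node S" for K x r and l :: "real ^ 'm ^ 'v"
  proof -
    let ?g = "\<lambda>i. g i (block node i x)" and ?D = "disagreement E l"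
    have "(l $ i - l $ r) \<bullet> ?g i \<le> c * ?D * B i" for i
    proof -
      have "(l $ i - l $ r) \<bullet> ?g i \<le> norm (l $ i - l $ r) * norm (?g i)"
        by (rule norm_cauchy_schwarz)
      also have "\<dots> \<le> (c * ?D) * B i"
        using x \<open>c > 0\<close> by (intro mult_mono c B) (auto simp: block_prod_def disagreement_nonneg)
      finally show ?thesis .
    qed
    then have "(\<Sum>i\<in>UNIV. (l $ i - l $ r) \<bullet> ?g i) \<le> (\<Sum>i\<in>UNIV. c * ?D * B i)"
      by (intro sum_mono)
    also have "\<dots> = (K0 - 1) * ?D"
      by (simp add: K0_def b_def sum_distrib_left[symmetric])
    also have "\<dots> \<le> (K - 1) * ?D"
      using \<open>K \<ge> K0\<close> by (intro mult_right_mono disagreement_nonneg) simp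
    finally show ?thesis
      by (simp add: modified_lagrangian_def sum.distrib inner_diff_left sum_subtractf algebra_simps)
  qed
  ultimately show ?thesis by blast
qed

section \<open>The equivalences\<close>

lemma consensus_in_multiplier_orthant_iff:
  "(\<chi> i. l0) \<in> multiplier_orthant \<longleftrightarrow> l0 \<in> nonneg_orthant"
  by (simp add: multiplier_orthant_def)

lemma projected_equilibrium_iff_modified_saddle:
  fixes node :: "'d::finite \<Rightarrow> 'v::finite" and g :: "'v \<Rightarrow> real ^ 'd \<Rightarrow> real ^ 'm::finite"
  assumes "\<And>i. openin (top_of_set (block_space node i)) (U i)"
    and "\<And>i. \<Omega> i \<subseteq> U i" and "\<And>i. convex (\<Omega> i)"
    and "\<And>i. convex_on (U i) (f i)" and "\<And>i k. convex_on (U i) (\<lambda>x. g i x $ k)"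
    and "0 \<le> K"
  shows "projected_equilibrium node E K U \<Omega> f g x l \<longleftrightarrow> modified_saddle node E K \<Omega> f g x l"
proof (cases "x \<in> block_prod node \<Omega> \<and> l \<in> multiplier_orthant")
  case True
  then have x: "x \<in> block_prod node \<Omega>" and l: "l \<in> multiplier_orthant" by auto
  have sub: "block_prod node \<Omega> \<subseteq> block_prod node U"
    using assms(2) by (auto simp: block_prod_def)
  note primal = projected_stationary_iff_minimizer[OF
      convex_on_modified_lagrangian_primal[OF assms(4,5) l]
      open_block_prod[OF assms(1)] convex_block_prod[OF assms(3)] sub x]
  note dual = projected_stationary_iff_minimizer[OF
      convex_on_modified_lagrangian_dual[OF \<open>0 \<le> K\<close>] open_UNIV convex_multiplier_orthant
      subset_UNIV l]
  show ?thesis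
    unfolding projected_equilibrium_def modified_saddle_def saddle_point_def primal dual
    using x l by auto
next
  case False
  then show ?thesis
    by (auto simp: projected_equilibrium_def modified_saddle_def saddle_point_def)
qed

lemma modified_saddle_iff_consensus_saddle:
  fixes E :: "('v::finite \<times> 'v) set" and l :: "real ^ 'm::finite ^ 'v"
  assumes gain: "\<And>x r. \<And>l :: real ^ 'm ^ 'v. x \<in> block_prod node \<Omega> \<Longrightarrow>
      modified_lagrangian node E K f g x l + disagreement E l
        \<le> modified_lagrangian node E K f g x (\<chi> i. l $ r)"
    and connected: "\<And>i j. (i, j) \<in> E\<^sup>*"
  shows "modified_saddle node E K \<Omega> f g x l \<longleftrightarrow> consensus_saddle node \<Omega> f g x l"
proof
  assume saddle: "modified_saddle node E K \<Omega> f g x l"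
  then have x: "x \<in> block_prod node \<Omega>" and l: "l \<in> multiplier_orthant"
    and max: "\<And>m. m \<in> multiplier_orthant \<Longrightarrow>
      modified_lagrangian node E K f g x m \<le> modified_lagrangian node E K f g x l"
    and min: "\<And>y. y \<in> block_prod node \<Omega> \<Longrightarrow>
      modified_lagrangian node E K f g x l \<le> modified_lagrangian node E K f g y l"
    unfolding modified_saddle_def saddle_point_def by blast+
  fix r :: 'v
  have r: "l $ r \<in> nonneg_orthant"
    using l by (simp add: multiplier_orthant_def)
  have "disagreement E l \<le> 0"
    using gain[OF x, of l r] max[of "\<chi> i. l $ r"] r
    by (simp add: consensus_in_multiplier_orthant_iff)
  then have "disagreement E l = 0"
    using disagreement_nonneg[of E l] by linarith
  moreover obtain c where
    "\<And>i j. \<And>l :: real ^ 'm ^ 'v. norm (l $ i - l $ j) \<le> c * disagreement E l"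
    using connected_disagreement_bound[OF connected] by blast
  ultimately have "norm (l $ i - l $ r) \<le> 0" for i
    by (metis mult_zero_right)
  then have "l $ i = l $ r" for i
    by simp
  then have cons: "l = (\<chi> i. l $ r)"
    by (simp add: vec_eq_iff)
  show "consensus_saddle node \<Omega> f g x l"
    unfolding consensus_saddle_def saddle_point_def
  proof (intro exI conjI ballI)
    show "l = (\<chi> i. l $ r)" by (fact cons)
    fix y m assume "y \<in> block_prod node \<Omega>" "m \<in> (nonneg_orthant :: (real ^ 'm) set)"
    then show "lagrangian node f g x m \<le> lagrangian node f g x (l $ r)"
      and "lagrangian node f g x (l $ r) \<le> lagrangian node f g y (l $ r)"
      using max[of "\<chi> i. m"] min[of y] cons
      by (metis consensus_in_multiplier_orthant_iff modified_lagrangian_consensus)+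
  qed (use x r in auto)
next
  assume "consensus_saddle node \<Omega> f g x l"
  then obtain l0 where l: "l = (\<chi> i. l0)" and x: "x \<in> block_prod node \<Omega>"
    and l0: "l0 \<in> nonneg_orthant"
    and max: "\<And>m. m \<in> nonneg_orthant \<Longrightarrow> lagrangian node f g x m \<le> lagrangian node f g x l0"
    and min: "\<And>y. y \<in> block_prod node \<Omega> \<Longrightarrow> lagrangian node f g x l0 \<le> lagrangian node f g y l0"
    unfolding consensus_saddle_def saddle_point_def by blast
  have "modified_lagrangian node E K f g x m \<le> lagrangian node f g x l0"
    if "m \<in> multiplier_orthant" for m
  proof -
    fix r :: 'v
    have "modified_lagrangian node E K f g x m \<le> modified_lagrangian node E K f g x (\<chi> i. m $ r)"
      using gain[OF x, of m r] disagreement_nonneg[of E m] by linarith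
    also have "\<dots> = lagrangian node f g x (m $ r)"
      by (rule modified_lagrangian_consensus)
    also have "\<dots> \<le> lagrangian node f g x l0"
      using that by (intro max) (simp add: multiplier_orthant_def)
    finally show ?thesis .
  qed
  then show "modified_saddle node E K \<Omega> f g x l"
    unfolding modified_saddle_def saddle_point_def l
    using x l0 min by (simp add: modified_lagrangian_consensus consensus_in_multiplier_orthant_iff)
qed

lemma strictly_convex_on_imp_convex_on:
  assumes "strictly_convex_on S f"
  shows "convex_on S f"
  unfolding convex_on_def
proof (intro conjI ballI allI impI)
  show "convex S" using assms by (simp add: strictly_convex_on_def)
  fix x y and u v :: real
  assume xy: "x \<in> S" "y \<in> S" and uv: "0 \<le> u" "0 \<le> v" "u + v = 1"
  \<comment> \<open>The strict inequality is only available for distinct points and positive weights.\<close>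
  consider "x = y" | "u = 0" | "v = 0" | "x \<noteq> y" "u > 0" "v > 0"
    using uv by linarith
  then show "f (u *\<^sub>R x + v *\<^sub>R y) \<le> u * f x + v * f y"
  proof cases
    case 1
    then show ?thesis
      using uv by (metis distrib_right mult_1 order_refl scaleR_left_distrib scaleR_one)
  next
    case 4
    then show ?thesis
      using assms xy uv unfolding strictly_convex_on_def by (meson less_imp_le)
  qed (use uv in auto)
qed

theorem mainTheorem2:
  fixes node :: "'d::finite \<Rightarrow> 'v::finite"
    and E :: "('v \<times> 'v) set"
    and U \<Omega> :: "'v \<Rightarrow> (real ^ 'd) set"
    and f :: "'v \<Rightarrow> real ^ 'd \<Rightarrow> real"
    and g :: "'v \<Rightarrow> real ^ 'd \<Rightarrow> real ^ 'm::finite"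
  assumes domain_open: "\<And>i. openin (top_of_set (block_space node i)) (U i)"
    and domain: "\<And>i. \<Omega> i \<subseteq> U i"
    and compact: "\<And>i. compact (\<Omega> i)"
    and convex: "\<And>i. convex (\<Omega> i)"
    and f_convex: "\<And>i. strictly_convex_on (U i) (f i)"
    and g_convex: "\<And>i k. convex_on (U i) (\<lambda>x. g i x $ k)"
    and f_lipschitz: "\<And>i. locally_lipschitz_on (U i) (f i)"
    and g_lipschitz: "\<And>i. locally_lipschitz_on (U i) (g i)"
    and slater: "\<exists>x \<in> rel_interior (block_prod node \<Omega>). \<forall>k. total_constraint node g x $ k < 0"
    and undirected: "sym E"
    and connected: "\<And>i j. (i, j) \<in> E\<^sup>*"
  shows "\<exists>K0>0. \<forall>K>0. \<forall>(x :: real ^ 'd) (l :: real ^ 'm ^ 'v).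
           (projected_equilibrium node E K U \<Omega> f g x l \<longleftrightarrow> modified_saddle node E K \<Omega> f g x l) \<and>
           (K \<ge> K0 \<longrightarrow>
              (modified_saddle node E K \<Omega> f g x l \<longleftrightarrow> consensus_saddle node \<Omega> f g x l))"
proof -
  have cont: "continuous_on (U i) (g i)" for i
    using g_lipschitz[of i] unfolding locally_lipschitz_on_def
    by (rule local_lipschitz_continuous_on) simp
  have bounded: "bounded (g i ` \<Omega> i)" for i
    using compact domain
    by (intro compact_imp_bounded compact_continuous_image continuous_on_subset[OF cont]) auto
  obtain K0 where "K0 > 0" and K0: "\<forall>K\<ge>K0. \<forall>x\<in>block_prod node \<Omega>. \<forall>(l :: real ^ 'm ^ 'v) r.
      modified_lagrangian node E K f g x l + disagreement E l
        \<le> modified_lagrangian node E K f g x (\<chi> i. l $ r)"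
    using consensus_replacement_gain[where g = g and S = \<Omega> and f = f and node = node, OF bounded connected]
    by blast
  show ?thesis
  proof (intro exI[of _ K0] conjI allI impI)
    fix K :: real and x :: "real ^ 'd" and l :: "real ^ 'm ^ 'v"
    assume "K > 0"
    then show "projected_equilibrium node E K U \<Omega> f g x l \<longleftrightarrow> modified_saddle node E K \<Omega> f g x l"
      by (intro projected_equilibrium_iff_modified_saddle domain_open domain convex g_convex
          strictly_convex_on_imp_convex_on f_convex) simp
    assume "K \<ge> K0"
    then show "modified_saddle node E K \<Omega> f g x l \<longleftrightarrow> consensus_saddle node \<Omega> f g x l"
      using K0 by (intro modified_saddle_iff_consensus_saddle connected) auto
  qed (fact \<open>K0 > 0\<close>)
qed

end
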